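(* Let $(A,\rhd,\lhd,\mathfrak{B},P)$ be a skew-symmetric Rota-Baxter Frobenius dialgebra of weight $0$, and let $\varphi_{\mathfrak{B}}:A\to A^*$ be the linear isomorphism $\langle\varphi_{\mathfrak B}(x),y\rangle=\mathfrak{B}(x,y)$. Then $(A,\rhd,\lhd,\delta_{\rhd,r},\delta_{\lhd,r})$ is a triangular bi-dialgebra, where $r\in A\otimes A$ is the 2-tensor form of $P\circ\varphi_{\mathfrak{B}}^{-1}$, given by $$\langle r,a^*\otimes b^*\rangle=\langle(P\circ\varphi_{\mathfrak{B}}^{-1})(a^* ),b^*\rangle,\qquad a^*,b^*\in A^*,$$ and $\delta_{\rhd,r}(x)=(R_{\star}(x)\otimes\mathrm{id}+\mathrm{id}\otimes L_{\lhd}(x))r$, $\delta_{\lhd,r}(x)=(R_{\rhd}(x)\otimes\mathrm{id}-\mathrm{id}\otimes L_{\star}(x))r$ for $x\in A$.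
   Context: All vector spaces and algebras are finite-dimensional over a field $\mathbb F$ of characteristic $0$; algebras are not assumed unital. Notation: $x\star y=x\rhd y-x\lhd y$; $L_\diamond(x)y=x\diamond y=R_\diamond(y)x$; $\tau(x\otimes y)=y\otimes x$. **Dialgebra.** $(A,\rhd,\lhd)$ where $\rhd,\lhd$ are associative bilinear products with $(x\lhd y)\lhd z=x\lhd(y\rhd z)$, $(x\rhd y)\lhd z=x\rhd(y\lhd z)$, $(x\lhd y)\rhd z=x\rhd(y\rhd z)$. A bilinear form $\mathfrak{B}$ on it is invariant if $\mathfrak{B}(x\rhd y,z)=\mathfrak{B}(x,y\rhd z-y\lhd z)$ and $\mathfrak{B}(x\lhd y,z)=\mathfrak{B}(x,y\rhd z)$. A skew-symmetric Frobenius dialgebra is a dialgebra with a nondegenerate skew-symmetric invariant bilinear form. **Rota-Baxter.** A Rota-Baxter operator of weight $\lambda\in\mathbb F$ on a dialgebra is a linear map $P:A\to A$ with $P(x)\diamond P(y)=P(P(x)\diamond y+x\diamond P(y)+\lambda\,x\diamond y)$ for $\diamond\in\{\rhd,\lhd\}$ and all $x,y$. A skew-symmetric Rota-Baxter Frobenius dialgebra of weight $\lambda$ is $(A,\rhd,\lhd,\mathfrak{B},P)$ with $(A,\rhd,\lhd,\mathfrak{B})$ a skew-symmetric Frobenius dialgebra, $P$ a Rota-Baxter operator of weight $\lambda$ on $(A,\rhd,\lhd)$, and $\mathfrak{B}(P(x),y)+\mathfrak{B}(x,P(y))+\lambda\mathfrak{B}(x,y)=0$ for all $x,y$. **Co-dialgebra.**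 $(A,\delta_{\rhd},\delta_{\lhd})$ with $\delta_{\rhd},\delta_{\lhd}:A\to A\otimes A$ linear and coassociative with $(\mathrm{id}\otimes\delta_{\lhd})\delta_{\lhd}=(\mathrm{id}\otimes\delta_{\rhd})\delta_{\lhd}$, $(\delta_{\rhd}\otimes\mathrm{id})\delta_{\lhd}=(\mathrm{id}\otimes\delta_{\lhd})\delta_{\rhd}$, $(\delta_{\lhd}\otimes\mathrm{id})\delta_{\rhd}=(\delta_{\rhd}\otimes\mathrm{id})\delta_{\rhd}$. **Bi-dialgebra.** $(A,\rhd,\lhd,\delta_{\rhd},\delta_{\lhd})$, a dialgebra and a co-dialgebra such that, with $\delta_\star=\delta_{\rhd}-\delta_{\lhd}$, for all $x,y\in A$: $(\mathrm{id}\otimes L_{\lhd}(x))\delta_{\lhd}(y)=(R_{\rhd}(y)\otimes\mathrm{id})\delta_{\rhd}(x)$; $(L_{\lhd}(x)\otimes\mathrm{id})\delta_{\rhd}(y)=(\mathrm{id}\otimes L_{\lhd}(y))\tau\delta_{\rhd}(x)$; $(R_{\rhd}(x)\otimes\mathrm{id})\tau\delta_{\lhd}(y)=(\mathrm{id}\otimes R_{\rhd}(y))\delta_{\lhd}(x)$; $\delta_{\rhd}(x\rhd y)=(\mathrm{id}\otimes L_{\rhd}(x))\delta_{\rhd}(y)-(R_{\star}(y)\otimes\mathrm{id})\delta_{\star}(x)$; $\delta_{\rhd}(x\lhd y)=(\mathrm{id}\otimes L_{\lhd}(x))\delta_{\star}(y)+(R_{\lhd}(y)\otimes\mathrm{id})\delta_{\rhd}(x)$;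 $\delta_{\lhd}(x\rhd y)=(\mathrm{id}\otimes L_{\star}(x))\delta_{\lhd}(y)+(R_{\rhd}(y)\otimes\mathrm{id})\delta_{\lhd}(x)$; $\delta_{\lhd}(x\lhd y)=(R_{\lhd}(y)\otimes\mathrm{id})\delta_{\lhd}(x)-(\mathrm{id}\otimes L_{\star}(x))\delta_{\star}(y)$; $(L_{\star}(x)\otimes\mathrm{id})\delta_{\rhd}(y)+(\mathrm{id}\otimes L_{\lhd}(y))\tau\delta_{\lhd}(x)=(R_{\star}(y)\otimes\mathrm{id})\tau\delta_{\star}(x)+(\mathrm{id}\otimes R_{\lhd}(x))\delta_{\rhd}(y)$; $(R_{\lhd}(x)\otimes\mathrm{id})\tau\delta_{\lhd}(y)+(\mathrm{id}\otimes R_{\rhd}(y))\delta_{\star}(x)=(L_{\star}(y)\otimes\mathrm{id})\delta_{\star}(x)+(\mathrm{id}\otimes L_{\rhd}(x))\tau\delta_{\lhd}(y)$. **Triangular.** $r=\sum_i a_i\otimes b_i$ solves the diassociative Yang-Baxter equation (DAYBE) if $\sum_{i,j}\big(a_i\otimes a_j\otimes b_i\rhd b_j-a_j\otimes a_i\lhd b_j\otimes b_i-a_i\star a_j\otimes b_i\otimes b_j\big)=0$. If $r$ is a symmetric ($\tau(r)=r$) solution of the DAYBE, the bi-dialgebra $(A,\rhd,\lhd,\delta_{\rhd,r},\delta_{\lhd,r})$ is called triangular. *)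

theory Defs
  imports Complex_Main "HOL-Library.Function_Algebras"
begin

lemma sum_fun_apply: "(\<Sum>i\<in>I. F i) x = (\<Sum>i\<in>I. F i x)"
  by (induction I rule: infinite_finite_induct) auto

definition bilinear_map ::
    "('f::field \<Rightarrow> 'a::ab_group_add \<Rightarrow> 'a) \<Rightarrow> ('f \<Rightarrow> 'b::ab_group_add \<Rightarrow> 'b) \<Rightarrow> ('a \<Rightarrow> 'a \<Rightarrow> 'b) \<Rightarrow> bool" where
  "bilinear_map s t \<beta> \<longleftrightarrow>
     (\<forall>x. Vector_Spaces.linear s t (\<lambda>y. \<beta> x y)) \<and> (\<forall>y. Vector_Spaces.linear s t (\<lambda>x. \<beta> x y))"

definition Lmul :: "('a \<Rightarrow> 'a \<Rightarrow> 'a) \<Rightarrow> 'a \<Rightarrow> 'a \<Rightarrow> 'a" where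
  "Lmul d x = (\<lambda>y. d x y)"

definition Rmul :: "('a \<Rightarrow> 'a \<Rightarrow> 'a) \<Rightarrow> 'a \<Rightarrow> 'a \<Rightarrow> 'a" where
  "Rmul d y = (\<lambda>x. d x y)"


section \<open>Tensor powers of a finite-dimensional vector space\<close>

text \<open>
  The underlying space \<open>A\<close> is the whole type \<open>'a\<close>. Its tensor square is realised inside the
  bilinear forms on the dual space: the pure tensor of \<open>a\<close> and \<open>b\<close> is the form
  \<open>(f, g) \<mapsto> f a * g b\<close>, and \<open>tensor2\<close> consists of the finite sums of pure tensors. Hence the
  pairing of a tensor \<open>t\<close> with \<open>f \<otimes> g\<close> is the application \<open>t f g\<close>. Forms are extended by \<open>0\<close> to
  arguments which are not linear functionals, so that equality of tensors is plain equality of HOL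
  functions. The lemma \<open>tensor2_universal\<close> below shows that \<open>tensor2\<close> has the universal property
  of the tensor square.
\<close>

type_synonym ('a, 'f) tensor2 = "('a \<Rightarrow> 'f) \<Rightarrow> ('a \<Rightarrow> 'f) \<Rightarrow> 'f"
type_synonym ('a, 'f) tensor3 = "('a \<Rightarrow> 'f) \<Rightarrow> ('a \<Rightarrow> 'f) \<Rightarrow> ('a \<Rightarrow> 'f) \<Rightarrow> 'f"

definition tensor2_scale :: "'f::field \<Rightarrow> ('a, 'f) tensor2 \<Rightarrow> ('a, 'f) tensor2" where
  "tensor2_scale c t = (\<lambda>f g. c * t f g)"

definition flip :: "('a, 'f) tensor2 \<Rightarrow> ('a, 'f) tensor2" (\<open>\<tau>\<close>) where
  "\<tau> t = (\<lambda>f g. t g f)"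

text \<open>
  \<open>(\<delta> \<otimes> id) t\<close> and \<open>(id \<otimes> \<delta>) t\<close> for \<open>t\<close> in \<open>tensor2\<close> and \<open>\<delta>\<close> a linear map into \<open>tensor2\<close>;
  see \<open>map_left_pure\<close> and \<open>map_right_pure\<close> for the values on pure tensors.
\<close>

definition map_left :: "('a \<Rightarrow> ('a, 'f) tensor2) \<Rightarrow> ('a, 'f) tensor2 \<Rightarrow> ('a, 'f) tensor3" where
  "map_left \<delta> t = (\<lambda>f g h. t (\<lambda>x. \<delta> x f g) h)"

definition map_right :: "('a \<Rightarrow> ('a, 'f) tensor2) \<Rightarrow> ('a, 'f) tensor2 \<Rightarrow> ('a, 'f) tensor3" where
  "map_right \<delta> t = (\<lambda>f g h. t f (\<lambda>x. \<delta> x g h))"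

locale fd_space = finite_dimensional_vector_space scale Basis
  for scale :: "'f::field_char_0 \<Rightarrow> 'a::ab_group_add \<Rightarrow> 'a" (infixr \<open>*s\<close> 75)
    and Basis :: "'a set"
begin

definition dual :: "('a \<Rightarrow> 'f) set" where
  "dual = {f. Vector_Spaces.linear scale (*) f}"

definition pure2 :: "'a \<Rightarrow> 'a \<Rightarrow> ('a, 'f) tensor2" (infixr \<open>\<otimes>\<close> 72) where
  "a \<otimes> b = (\<lambda>f g. if f \<in> dual \<and> g \<in> dual then f a * g b else 0)"

definition pure3 :: "'a \<Rightarrow> 'a \<Rightarrow> 'a \<Rightarrow> ('a, 'f) tensor3" where
  "pure3 a b c = (\<lambda>f g h. if f \<in> dual \<and> g \<in> dual \<and> h \<in> dual then f a * g b * h c else 0)"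

definition tensor2 :: "('a, 'f) tensor2 set" where
  "tensor2 = {t. \<exists>(n::nat) a b. t = (\<Sum>i<n. a i \<otimes> b i)}"

text \<open>The tensor product of two linear endomorphisms; see \<open>tmap_pure\<close>.\<close>

definition tmap :: "('a \<Rightarrow> 'a) \<Rightarrow> ('a \<Rightarrow> 'a) \<Rightarrow> ('a, 'f) tensor2 \<Rightarrow> ('a, 'f) tensor2"
    (infixr \<open>\<otimes>\<^sub>m\<close> 72) where
  "S \<otimes>\<^sub>m T = (\<lambda>t f g. if f \<in> dual \<and> g \<in> dual then t (\<lambda>x. f (S x)) (\<lambda>x. g (T x)) else 0)"

text \<open>The 2-tensor form of \<open>Q : A\<^sup>* \<rightarrow> A\<close>: its pairing with \<open>f \<otimes> g\<close> is \<open>g (Q f)\<close>.\<close>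

definition tensor_form :: "(('a \<Rightarrow> 'f) \<Rightarrow> 'a) \<Rightarrow> ('a, 'f) tensor2" where
  "tensor_form Q = (\<lambda>f g. if f \<in> dual \<and> g \<in> dual then g (Q f) else 0)"

lemma vector_space_field: "vector_space ((*) :: 'f \<Rightarrow> 'f \<Rightarrow> 'f)"
  by unfold_locales (auto simp: algebra_simps)

lemma dual_iff: "f \<in> dual \<longleftrightarrow> (\<forall>x y. f (x + y) = f x + f y) \<and> (\<forall>c x. f (c *s x) = c * f x)"
proof -
  have "module scale" "module ((*) :: 'f \<Rightarrow> 'f \<Rightarrow> 'f)"
    using vector_space_axioms vector_space_field by (simp_all add: module_iff_vector_space)
  then show ?thesis
    by (auto simp: dual_def linear_iff_module_hom module_hom_iff)
qed

lemma tmap_pure: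
  fixes n :: nat
  assumes "Vector_Spaces.linear scale scale S" "Vector_Spaces.linear scale scale T"
  shows "(S \<otimes>\<^sub>m T) (\<Sum>i<n. a i \<otimes> b i) = (\<Sum>i<n. S (a i) \<otimes> T (b i))"
proof -
  interpret S: Vector_Spaces.linear scale scale S by fact
  interpret T: Vector_Spaces.linear scale scale T by fact
  have "(\<lambda>x. f (S x)) \<in> dual" "(\<lambda>x. f (T x)) \<in> dual" if "f \<in> dual" for f
    using that by (auto simp: dual_iff S.add S.scale T.add T.scale)
  then show ?thesis
    by (auto simp: fun_eq_iff tmap_def pure2_def sum_fun_apply)
qed

lemma flip_pure: "\<tau> (\<Sum>i<(n::nat). a i \<otimes> b i) = (\<Sum>i<n. b i \<otimes> a i)"
  by (auto simp: fun_eq_iff flip_def pure2_def sum_fun_apply intro!: sum.cong)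

lemma map_left_pure:
  fixes n :: nat and m :: "nat \<Rightarrow> nat"
  assumes "Vector_Spaces.linear scale tensor2_scale \<delta>" "\<And>i. i < n \<Longrightarrow> \<delta> (a i) = (\<Sum>j<m i. c i j \<otimes> d i j)"
  shows "map_left \<delta> (\<Sum>i<n. a i \<otimes> b i) = (\<Sum>i<n. \<Sum>j<m i. pure3 (c i j) (d i j) (b i))"
proof (intro ext)
  fix f g h
  interpret d: Vector_Spaces.linear scale tensor2_scale \<delta> by fact
  have "(\<lambda>x. \<delta> x f g) \<in> dual"
    by (auto simp: dual_iff d.add d.scale tensor2_scale_def)
  then show "map_left \<delta> (\<Sum>i<n. a i \<otimes> b i) f g h = (\<Sum>i<n. \<Sum>j<m i. pure3 (c i j) (d i j) (b i)) f g h"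
    by (cases "h \<in> dual")
      (auto simp: map_left_def pure2_def pure3_def sum_fun_apply assms(2) sum_distrib_right intro!: sum.cong)
qed

lemma map_right_pure:
  fixes n :: nat and m :: "nat \<Rightarrow> nat"
  assumes "Vector_Spaces.linear scale tensor2_scale \<delta>" "\<And>i. i < n \<Longrightarrow> \<delta> (b i) = (\<Sum>j<m i. c i j \<otimes> d i j)"
  shows "map_right \<delta> (\<Sum>i<n. a i \<otimes> b i) = (\<Sum>i<n. \<Sum>j<m i. pure3 (a i) (c i j) (d i j))"
proof (intro ext)
  fix f g h
  interpret d: Vector_Spaces.linear scale tensor2_scale \<delta> by fact
  have "(\<lambda>x. \<delta> x g h) \<in> dual"
    by (auto simp: dual_iff d.add d.scale tensor2_scale_def)
  then show "map_right \<delta> (\<Sum>i<n. a i \<otimes> b i) f g h = (\<Sum>i<n. \<Sum>j<m i. pure3 (a i) (c i j) (d i j)) f g h"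
    by (cases "f \<in> dual")
      (auto simp: map_right_def pure2_def pure3_def sum_fun_apply assms(2) sum_distrib_left mult.assoc intro!: sum.cong)
qed

lemma representation_dual: "(\<lambda>x. representation Basis x e) \<in> dual"
  by (simp add: dual_iff representation_add representation_scale independent_Basis span_Basis)

lemma basis_expansion: "x = (\<Sum>e\<in>Basis. representation Basis x e *s e)"
  using sum_representation_eq[OF independent_Basis, of x Basis] by (simp add: finite_Basis span_Basis)

lemma tensor2_universal:
  fixes n m :: nat
  assumes "vector_space s" "bilinear_map scale s \<beta>"
    and eq: "(\<Sum>i<n. a i \<otimes> b i) = (\<Sum>j<m. c j \<otimes> d j)"
  shows "(\<Sum>i<n. \<beta> (a i) (b i)) = (\<Sum>j<m. \<beta> (c j) (d j))"
proof -
  interpret W: vector_space s by fact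
  let ?R = "representation Basis"
  have expand: "\<beta> x y = (\<Sum>e\<in>Basis. \<Sum>e'\<in>Basis. s (?R x e * ?R y e') (\<beta> e e'))" for x y
  proof -
    interpret l: Vector_Spaces.linear scale s "\<lambda>x. \<beta> x y"
      using assms(2) by (simp add: bilinear_map_def)
    have "\<beta> x y = (\<Sum>e\<in>Basis. s (?R x e) (\<beta> e y))"
      by (subst basis_expansion[of x]) (simp add: l.sum l.scale)
    also have "\<dots> = (\<Sum>e\<in>Basis. s (?R x e) (\<Sum>e'\<in>Basis. s (?R y e') (\<beta> e e')))"
    proof (intro sum.cong refl)
      fix e
      interpret r: Vector_Spaces.linear scale s "\<beta> e"
        using assms(2) by (simp add: bilinear_map_def)
      show "s (?R x e) (\<beta> e y) = s (?R x e) (\<Sum>e'\<in>Basis. s (?R y e') (\<beta> e e'))"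
        by (subst basis_expansion[of y]) (simp add: r.sum r.scale)
    qed
    finally show ?thesis by (simp add: W.scale_sum_right)
  qed
  have sums: "(\<Sum>i<k. \<beta> (p i) (q i)) =
      (\<Sum>e\<in>Basis. \<Sum>e'\<in>Basis. s ((\<Sum>i<k. p i \<otimes> q i) (\<lambda>x. ?R x e) (\<lambda>x. ?R x e')) (\<beta> e e'))"
    for k :: nat and p q
  proof -
    have "(\<Sum>i<k. \<beta> (p i) (q i)) = (\<Sum>i<k. \<Sum>e\<in>Basis. \<Sum>e'\<in>Basis. s (?R (p i) e * ?R (q i) e') (\<beta> e e'))"
      by (subst expand) simp
    also have "\<dots> = (\<Sum>e\<in>Basis. \<Sum>e'\<in>Basis. \<Sum>i<k. s (?R (p i) e * ?R (q i) e') (\<beta> e e'))"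
      by (subst sum.swap, intro sum.cong refl, rule sum.swap)
    finally show ?thesis
      by (simp add: sum_fun_apply pure2_def representation_dual W.scale_sum_left)
  qed
  show ?thesis using sums[of a b n] sums[of c d m] eq by simp
qed

end


section \<open>Dialgebras\<close>

locale dialgebra = fd_space scale Basis
  for scale :: "'f::field_char_0 \<Rightarrow> 'a::ab_group_add \<Rightarrow> 'a" (infixr \<open>*s\<close> 75)
    and Basis :: "'a set" +
  fixes rhd :: "'a \<Rightarrow> 'a \<Rightarrow> 'a" (infixl \<open>\<rhd>\<close> 70)
    and lhd :: "'a \<Rightarrow> 'a \<Rightarrow> 'a" (infixl \<open>\<lhd>\<close> 70)
  assumes rhd_bilinear: "bilinear_map scale scale (\<rhd>)"
    and lhd_bilinear: "bilinear_map scale scale (\<lhd>)"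
    and rhd_assoc: "(x \<rhd> y) \<rhd> z = x \<rhd> (y \<rhd> z)"
    and lhd_assoc: "(x \<lhd> y) \<lhd> z = x \<lhd> (y \<lhd> z)"
    and lhd_lhd: "(x \<lhd> y) \<lhd> z = x \<lhd> (y \<rhd> z)"
    and rhd_lhd: "(x \<rhd> y) \<lhd> z = x \<rhd> (y \<lhd> z)"
    and lhd_rhd: "(x \<lhd> y) \<rhd> z = x \<rhd> (y \<rhd> z)"
begin

definition star :: "'a \<Rightarrow> 'a \<Rightarrow> 'a" (infixl \<open>\<star>\<close> 70) where
  "x \<star> y = x \<rhd> y - x \<lhd> y"

definition invariant :: "('a \<Rightarrow> 'a \<Rightarrow> 'f) \<Rightarrow> bool" where
  "invariant B \<longleftrightarrow>
     (\<forall>x y z. B (x \<rhd> y) z = B x (y \<rhd> z - y \<lhd> z)) \<and> (\<forall>x y z. B (x \<lhd> y) z = B x (y \<rhd> z))"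

definition rota_baxter :: "'f \<Rightarrow> ('a \<Rightarrow> 'a) \<Rightarrow> bool" where
  "rota_baxter l P \<longleftrightarrow> Vector_Spaces.linear scale scale P \<and>
     (\<forall>x y. P x \<rhd> P y = P (P x \<rhd> y + x \<rhd> P y + l *s (x \<rhd> y))) \<and>
     (\<forall>x y. P x \<lhd> P y = P (P x \<lhd> y + x \<lhd> P y + l *s (x \<lhd> y)))"

text \<open>
  The equation is required for every way of writing \<open>r\<close> as a finite sum of pure tensors; by
  trilinearity it does not depend on the choice, and by definition of \<open>tensor2\<close> there is one.
\<close>

definition daybe :: "('a, 'f) tensor2 \<Rightarrow> bool" where
  "daybe r \<longleftrightarrow> r \<in> tensor2 \<and>
     (\<forall>(n::nat) a b. r = (\<Sum>i<n. a i \<otimes> b i) \<longrightarrow>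
        (\<Sum>i<n. \<Sum>j<n. pure3 (a i) (a j) (b i \<rhd> b j) - pure3 (a j) (a i \<lhd> b j) (b i)
                        - pure3 (a i \<star> a j) (b i) (b j)) = 0)"

definition delta_rhd :: "('a, 'f) tensor2 \<Rightarrow> 'a \<Rightarrow> ('a, 'f) tensor2" where
  "delta_rhd r x = (Rmul (\<star>) x \<otimes>\<^sub>m id) r + (id \<otimes>\<^sub>m Lmul (\<lhd>) x) r"

definition delta_lhd :: "('a, 'f) tensor2 \<Rightarrow> 'a \<Rightarrow> ('a, 'f) tensor2" where
  "delta_lhd r x = (Rmul (\<rhd>) x \<otimes>\<^sub>m id) r - (id \<otimes>\<^sub>m Lmul (\<star>) x) r"

end

locale skew_frobenius_dialgebra = dialgebra scale Basis rhd lhd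
  for scale :: "'f::field_char_0 \<Rightarrow> 'a::ab_group_add \<Rightarrow> 'a" (infixr \<open>*s\<close> 75)
    and Basis :: "'a set"
    and rhd :: "'a \<Rightarrow> 'a \<Rightarrow> 'a" (infixl \<open>\<rhd>\<close> 70)
    and lhd :: "'a \<Rightarrow> 'a \<Rightarrow> 'a" (infixl \<open>\<lhd>\<close> 70) +
  fixes B :: "'a \<Rightarrow> 'a \<Rightarrow> 'f"
  assumes form_bilinear: "bilinear_map scale (*) B"
    and form_nondegenerate: "(\<And>y. B x y = 0) \<Longrightarrow> x = 0"
    and form_skew: "B x y = - B y x"
    and form_invariant: "invariant B"

locale skew_rota_baxter_frobenius_dialgebra = skew_frobenius_dialgebra scale Basis rhd lhd B
  for scale :: "'f::field_char_0 \<Rightarrow> 'a::ab_group_add \<Rightarrow> 'a" (infixr \<open>*s\<close> 75)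
    and Basis :: "'a set"
    and rhd :: "'a \<Rightarrow> 'a \<Rightarrow> 'a" (infixl \<open>\<rhd>\<close> 70)
    and lhd :: "'a \<Rightarrow> 'a \<Rightarrow> 'a" (infixl \<open>\<lhd>\<close> 70)
    and B :: "'a \<Rightarrow> 'a \<Rightarrow> 'f" +
  fixes P :: "'a \<Rightarrow> 'a" and weight :: 'f
  assumes operator_rota_baxter: "rota_baxter weight P"
    and operator_form: "B (P x) y + B x (P y) + weight * B x y = 0"

definition form_map :: "('a \<Rightarrow> 'a \<Rightarrow> 'f) \<Rightarrow> 'a \<Rightarrow> ('a \<Rightarrow> 'f)" where
  "form_map B x = (\<lambda>y. B x y)"

text \<open>
  Since \<open>form_map B\<close> is a bijection onto the dual space, \<open>inv (form_map B)\<close> is its inverse there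
  (its values outside the dual space are never used).
\<close>

lemma (in skew_frobenius_dialgebra) form_map_bij: "bij_betw (form_map B) UNIV dual"
proof -
  have lin1: "Vector_Spaces.linear scale (*) (B x)" for x
    using form_bilinear by (simp add: bilinear_map_def)
  have lin2: "B (x + x') y = B x y + B x' y" "B (c *s x) y = c * B x y" for x x' y c
  proof -
    interpret l: Vector_Spaces.linear scale "(*)" "\<lambda>x. B x y"
      using form_bilinear by (simp add: bilinear_map_def)
    show "B (x + x') y = B x y + B x' y" "B (c *s x) y = c * B x y"
      by (simp_all add: l.add l.scale)
  qed
  have det: "f = g" if "f \<in> dual" "g \<in> dual" "\<And>e. e \<in> Basis \<Longrightarrow> f e = g e" for f g
  proof
    fix x
    interpret f: Vector_Spaces.linear scale "(*)" f using that(1) by (simp add: dual_def)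
    interpret g: Vector_Spaces.linear scale "(*)" g using that(2) by (simp add: dual_def)
    show "f x = g x"
      by (subst (1 2) basis_expansion[of x]) (simp add: f.sum g.sum f.scale g.scale that(3))
  qed
  have B_dual: "B x \<in> dual" for x using lin1 by (simp add: dual_def)
  define \<psi> where "\<psi> x = (\<Sum>e\<in>Basis. B x e *s e)" for x
  have \<psi>_lin: "Vector_Spaces.linear scale scale \<psi>"
    unfolding linear_iff_module_hom module_hom_iff \<psi>_def
    by (simp add: module_axioms lin2 scale_left_distrib sum.distrib scale_sum_right)
  have coord: "u e = v e" if "(\<Sum>e\<in>Basis. u e *s e) = (\<Sum>e\<in>Basis. v e *s e)" "e \<in> Basis" for u v e
  proof -
    have "(\<Sum>e\<in>Basis. (u e - v e) *s e) = 0"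
      using that(1) by (simp add: scale_left_diff_distrib sum_subtractf)
    then have "u e - v e = 0"
      using independentD[OF independent_Basis finite_Basis order_refl _ that(2), of "\<lambda>e. u e - v e"] by simp
    then show ?thesis by simp
  qed
  have inj: "inj (form_map B)"
  proof (rule injI)
    fix x y assume "form_map B x = form_map B y"
    then have "B x z = B y z" for z by (simp add: form_map_def fun_eq_iff)
    moreover have "B (x - y) z = B x z - B y z" for z
      using lin2(1)[of "x - y" y z] by simp
    ultimately have "B (x - y) z = 0" for z by simp
    then show "x = y" using form_nondegenerate[of "x - y"] by simp
  qed
  have "inj \<psi>"
  proof (rule injI)
    fix x y assume "\<psi> x = \<psi> y"
    then have "B x e = B y e" if "e \<in> Basis" for e
      using coord[of "B x" "B y" e] that by (simp add: \<psi>_def)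
    then have "B x = B y" by (intro det B_dual)
    then show "x = y" using inj by (auto simp: form_map_def inj_def)
  qed
  then have surj: "surj \<psi>" using linear_inj_imp_surj[OF \<psi>_lin] by blast
  have "f \<in> range (form_map B)" if f: "f \<in> dual" for f
  proof -
    obtain x where x: "(\<Sum>e\<in>Basis. f e *s e) = \<psi> x" using surj by (metis surjD)
    have "f e = B x e" if "e \<in> Basis" for e
      using coord[of f "B x" e] x that by (simp add: \<psi>_def)
    then have "f = B x" by (intro det f B_dual)
    then show ?thesis by (auto simp: form_map_def)
  qed
  then show ?thesis
    using inj B_dual by (auto simp: bij_betw_def form_map_def)
qed


section \<open>Bi-dialgebras\<close>

locale co_dialgebra = fd_space scale Basis
  for scale :: "'f::field_char_0 \<Rightarrow> 'a::ab_group_add \<Rightarrow> 'a" (infixr \<open>*s\<close> 75)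
    and Basis :: "'a set" +
  fixes \<delta>r \<delta>l :: "'a \<Rightarrow> ('a, 'f) tensor2"
  assumes \<delta>r_tensor2: "\<delta>r x \<in> tensor2"
    and \<delta>l_tensor2: "\<delta>l x \<in> tensor2"
    and \<delta>r_linear: "Vector_Spaces.linear scale tensor2_scale \<delta>r"
    and \<delta>l_linear: "Vector_Spaces.linear scale tensor2_scale \<delta>l"
    and \<delta>r_coassoc: "map_left \<delta>r (\<delta>r x) = map_right \<delta>r (\<delta>r x)"
    and \<delta>l_coassoc: "map_left \<delta>l (\<delta>l x) = map_right \<delta>l (\<delta>l x)"
    and co_lhd_lhd: "map_right \<delta>l (\<delta>l x) = map_right \<delta>r (\<delta>l x)"
    and co_rhd_lhd: "map_left \<delta>r (\<delta>l x) = map_right \<delta>l (\<delta>r x)"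
    and co_lhd_rhd: "map_left \<delta>l (\<delta>r x) = map_left \<delta>r (\<delta>r x)"

locale bi_dialgebra = dialgebra scale Basis rhd lhd + co_dialgebra scale Basis \<delta>r \<delta>l
  for scale :: "'f::field_char_0 \<Rightarrow> 'a::ab_group_add \<Rightarrow> 'a" (infixr \<open>*s\<close> 75)
    and Basis :: "'a set"
    and rhd :: "'a \<Rightarrow> 'a \<Rightarrow> 'a" (infixl \<open>\<rhd>\<close> 70)
    and lhd :: "'a \<Rightarrow> 'a \<Rightarrow> 'a" (infixl \<open>\<lhd>\<close> 70)
    and \<delta>r \<delta>l :: "'a \<Rightarrow> ('a, 'f) tensor2" +
  assumes bi1: "(id \<otimes>\<^sub>m Lmul (\<lhd>) x) (\<delta>l y) = (Rmul (\<rhd>) y \<otimes>\<^sub>m id) (\<delta>r x)"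
    and bi2: "(Lmul (\<lhd>) x \<otimes>\<^sub>m id) (\<delta>r y) = (id \<otimes>\<^sub>m Lmul (\<lhd>) y) (\<tau> (\<delta>r x))"
    and bi3: "(Rmul (\<rhd>) x \<otimes>\<^sub>m id) (\<tau> (\<delta>l y)) = (id \<otimes>\<^sub>m Rmul (\<rhd>) y) (\<delta>l x)"
    and bi4: "\<delta>r (x \<rhd> y) = (id \<otimes>\<^sub>m Lmul (\<rhd>) x) (\<delta>r y) - (Rmul (\<star>) y \<otimes>\<^sub>m id) (\<delta>r x - \<delta>l x)"
    and bi5: "\<delta>r (x \<lhd> y) = (id \<otimes>\<^sub>m Lmul (\<lhd>) x) (\<delta>r y - \<delta>l y) + (Rmul (\<lhd>) y \<otimes>\<^sub>m id) (\<delta>r x)"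
    and bi6: "\<delta>l (x \<rhd> y) = (id \<otimes>\<^sub>m Lmul (\<star>) x) (\<delta>l y) + (Rmul (\<rhd>) y \<otimes>\<^sub>m id) (\<delta>l x)"
    and bi7: "\<delta>l (x \<lhd> y) = (Rmul (\<lhd>) y \<otimes>\<^sub>m id) (\<delta>l x) - (id \<otimes>\<^sub>m Lmul (\<star>) x) (\<delta>r y - \<delta>l y)"
    and bi8: "(Lmul (\<star>) x \<otimes>\<^sub>m id) (\<delta>r y) + (id \<otimes>\<^sub>m Lmul (\<lhd>) y) (\<tau> (\<delta>l x))
        = (Rmul (\<star>) y \<otimes>\<^sub>m id) (\<tau> (\<delta>r x - \<delta>l x)) + (id \<otimes>\<^sub>m Rmul (\<lhd>) x) (\<delta>r y)"
    and bi9: "(Rmul (\<lhd>) x \<otimes>\<^sub>m id) (\<tau> (\<delta>l y)) + (id \<otimes>\<^sub>m Rmul (\<rhd>) y) (\<delta>r x - \<delta>l x)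
        = (Lmul (\<star>) y \<otimes>\<^sub>m id) (\<delta>r x - \<delta>l x) + (id \<otimes>\<^sub>m Lmul (\<rhd>) x) (\<tau> (\<delta>l y))"

locale triangular_bi_dialgebra = bi_dialgebra scale Basis rhd lhd \<delta>r \<delta>l
  for scale :: "'f::field_char_0 \<Rightarrow> 'a::ab_group_add \<Rightarrow> 'a" (infixr \<open>*s\<close> 75)
    and Basis :: "'a set"
    and rhd :: "'a \<Rightarrow> 'a \<Rightarrow> 'a" (infixl \<open>\<rhd>\<close> 70)
    and lhd :: "'a \<Rightarrow> 'a \<Rightarrow> 'a" (infixl \<open>\<lhd>\<close> 70)
    and \<delta>r \<delta>l :: "'a \<Rightarrow> ('a, 'f) tensor2" +
  fixes r :: "('a, 'f) tensor2"
  assumes r_daybe: "daybe r"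
    and r_symmetric: "\<tau> r = r"
    and \<delta>r_eq: "\<delta>r = delta_rhd r"
    and \<delta>l_eq: "\<delta>l = delta_lhd r"

end

theory Submission
  imports Defs
begin

text \<open>
  Identifying \<open>A\<close> with its dual through the form turns a 2-tensor into an endomorphism \<open>T\<close>, read as
  \<open>(u, v) \<mapsto> B(v, T u)\<close>: then \<open>r\<close> becomes \<open>P\<close>, and by invariance \<open>\<delta>\<^sub>r(x)\<close> and \<open>\<delta>\<^sub>l(x)\<close> become the
  commutators of \<open>P\<close> with left multiplications by \<open>x\<close>. The compatibility conditions are then
  identities of endomorphisms following from the dialgebra axioms. In terms of products, the coproducts
  are dual to \<open>u \<diamond> P v + P u \<diamond> v\<close>, which form a dialgebra because \<open>P\<close> is Rota-Baxter of weight \<open>0\<close>;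
  dually this is the co-dialgebra structure.
\<close>

section \<open>Linear algebra of bilinear maps and tensor squares\<close>

lemma bilinear_mapD:
  assumes "bilinear_map s t \<beta>"
  shows "\<beta> (x + y) z = \<beta> x z + \<beta> y z" "\<beta> z (x + y) = \<beta> z x + \<beta> z y"
    "\<beta> (x - y) z = \<beta> x z - \<beta> y z" "\<beta> z (x - y) = \<beta> z x - \<beta> z y"
    "\<beta> (- x) z = - \<beta> x z" "\<beta> z (- x) = - \<beta> z x"
    "\<beta> 0 z = 0" "\<beta> z 0 = 0"
    "\<beta> (s c x) z = t c (\<beta> x z)" "\<beta> z (s c x) = t c (\<beta> z x)"
    "\<beta> (sum h I) z = (\<Sum>i\<in>I. \<beta> (h i) z)" "\<beta> z (sum h I) = (\<Sum>i\<in>I. \<beta> z (h i))"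
proof -
  interpret l: Vector_Spaces.linear s t "\<lambda>x. \<beta> x z"
    using assms by (simp add: bilinear_map_def)
  interpret r: Vector_Spaces.linear s t "\<beta> z"
    using assms by (simp add: bilinear_map_def)
  show "\<beta> (x + y) z = \<beta> x z + \<beta> y z" "\<beta> z (x + y) = \<beta> z x + \<beta> z y"
    "\<beta> (x - y) z = \<beta> x z - \<beta> y z" "\<beta> z (x - y) = \<beta> z x - \<beta> z y"
    "\<beta> (- x) z = - \<beta> x z" "\<beta> z (- x) = - \<beta> z x"
    "\<beta> 0 z = 0" "\<beta> z 0 = 0"
    "\<beta> (s c x) z = t c (\<beta> x z)" "\<beta> z (s c x) = t c (\<beta> z x)"
    "\<beta> (sum h I) z = (\<Sum>i\<in>I. \<beta> (h i) z)" "\<beta> z (sum h I) = (\<Sum>i\<in>I. \<beta> z (h i))"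
    by (simp_all add: l.add r.add l.diff r.diff l.neg r.neg l.scale r.scale l.sum r.sum)
qed

lemma vector_space_tensor2_scale:
  "vector_space (tensor2_scale :: 'f::field \<Rightarrow> ('a, 'f) tensor2 \<Rightarrow> ('a, 'f) tensor2)"
  by unfold_locales (auto simp: tensor2_scale_def fun_eq_iff algebra_simps)

lemma (in fd_space) linear_scaleI:
  assumes "\<And>x y. T (x + y) = T x + T y" "\<And>c x. T (c *s x) = c *s T x"
  shows "Vector_Spaces.linear scale scale T"
  using assms by (simp add: linear_iff_module_hom module_hom_iff module_axioms)

lemma (in fd_space) linear_tensor2I:
  fixes \<delta> :: "'a \<Rightarrow> ('a, 'f) tensor2"
  assumes "\<And>x y. \<delta> (x + y) = \<delta> x + \<delta> y" "\<And>c x. \<delta> (c *s x) = tensor2_scale c (\<delta> x)"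
  shows "Vector_Spaces.linear scale tensor2_scale \<delta>"
  using assms vector_space_tensor2_scale
  by (simp add: linear_iff_module_hom module_hom_iff module_iff_vector_space vector_space_axioms)

text \<open>Elements of \<open>tensor2\<close> are sums over initial segments of the naturals, so an
  enumeration of \<open>I\<close> reindexes the sum.\<close>

lemma (in fd_space) sum_pure2_in_tensor2:
  assumes "finite I"
  shows "(\<Sum>i\<in>I. a i \<otimes> b i) \<in> tensor2"
proof -
  obtain h where h: "bij_betw h {..<card I} I"
    using ex_bij_betw_nat_finite[OF assms] by (auto simp: atLeast0LessThan)
  then have "(\<Sum>i\<in>I. a i \<otimes> b i) = (\<Sum>k<card I. a (h k) \<otimes> b (h k))"
    by (intro sum.reindex_bij_betw[symmetric])
  then show ?thesis
    unfolding tensor2_def mem_Collect_eq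
    by (intro exI[of _ "card I"] exI[of _ "\<lambda>k. a (h k)"] exI[of _ "\<lambda>k. b (h k)"])
qed


section \<open>Adjoints with respect to the form, and 2-tensors as endomorphisms\<close>

context skew_frobenius_dialgebra
begin

lemmas B_bilin = bilinear_mapD[OF form_bilinear]
lemmas rhd_bilin = bilinear_mapD[OF rhd_bilinear]
lemmas lhd_bilin = bilinear_mapD[OF lhd_bilinear]

lemma star_bilinear: "bilinear_map scale scale (\<star>)"
  unfolding bilinear_map_def star_def
  by (safe intro!: linear_scaleI) (simp_all add: rhd_bilin lhd_bilin scale_right_diff_distrib)

lemmas star_bilin = bilinear_mapD[OF star_bilinear]

text \<open>Equivalently \<open>x \<lhd> (y \<star> z) = 0\<close>. As a rewrite rule it gives
  products to the right of \<open>\<lhd>\<close> a normal form.\<close>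

lemma lhd_absorb: "x \<lhd> (y \<lhd> z) = x \<lhd> (y \<rhd> z)"
  by (metis lhd_assoc lhd_lhd)

lemma form_eqI: "(\<And>v. B v x = B v y) \<Longrightarrow> x = y"
  using form_nondegenerate[of "x - y"] form_skew[of "x - y"] by (simp add: B_bilin)

lemma form_rhd_left: "B (x \<rhd> y) z = B x (y \<star> z)"
  using form_invariant by (simp add: invariant_def star_def)

lemma form_lhd_left: "B (x \<lhd> y) z = B x (y \<rhd> z)"
  using form_invariant by (simp add: invariant_def)

lemma form_star_left: "B (x \<star> y) z = - B x (y \<lhd> z)"
  unfolding star_def[of x y]
  by (simp add: B_bilin form_rhd_left form_lhd_left star_def)

text \<open>Skew-symmetry turns the previous three rules into adjoints of the right multiplications
  by \<open>y\<close>.\<close>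

lemma form_rhd_right: "B z (x \<rhd> y) = B (y \<star> z) x"
  using form_rhd_left[of x y z] form_skew[of z] form_skew[of x] by simp

lemma form_lhd_right: "B z (x \<lhd> y) = B (y \<rhd> z) x"
  using form_lhd_left[of x y z] form_skew[of z] form_skew[of x] by simp

lemma form_star_right: "B z (x \<star> y) = B (- (y \<lhd> z)) x"
  using form_star_left[of x y z] form_skew[of z "x \<star> y"] form_skew[of x "y \<lhd> z"]
  by (simp add: B_bilin)

lemma form_in_dual: "B u \<in> dual"
  by (simp add: dual_iff B_bilin)

lemma dualE:
  assumes "f \<in> dual"
  obtains u where "f = B u"
  using assms form_map_bij unfolding bij_betw_def by (auto simp: form_map_def)

lemma inv_form_map: "inv (form_map B) (B u) = u"
  using inv_f_f[of "form_map B" u] form_map_bij by (simp add: bij_betw_def form_map_def)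

text \<open>\<open>T\<close> may be any function, which spares the rules below linearity premises.
  Linearity enters with membership in \<open>tensor2\<close>.\<close>

definition endo_tensor :: "('a \<Rightarrow> 'a) \<Rightarrow> ('a, 'f) tensor2" where
  "endo_tensor T = tensor_form (T \<circ> inv (form_map B))"

lemma endo_tensor_form: "endo_tensor T (B u) (B v) = B v (T u)"
  by (simp add: endo_tensor_def tensor_form_def form_in_dual inv_form_map)

lemma endo_tensor_not_dual: "\<not> (f \<in> dual \<and> g \<in> dual) \<Longrightarrow> endo_tensor T f g = 0"
  by (auto simp: endo_tensor_def tensor_form_def)

text \<open>Every linear functional is some \<open>B u\<close>, by \<open>form_map_bij\<close>; on
  all other arguments both sides take the default value 0.\<close>

lemma eq_endo_tensorI:
  assumes "\<And>f g. \<not> (f \<in> dual \<and> g \<in> dual) \<Longrightarrow> t f g = 0"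
    and "\<And>u v. t (B u) (B v) = B v (T u)"
  shows "t = endo_tensor T"
proof (intro ext)
  fix f g
  show "t f g = endo_tensor T f g"
    using assms by (cases "f \<in> dual \<and> g \<in> dual")
      (auto simp: endo_tensor_not_dual endo_tensor_form elim!: dualE)
qed

lemma endo_tensor_add: "endo_tensor S + endo_tensor T = endo_tensor (\<lambda>u. S u + T u)"
  by (rule eq_endo_tensorI) (simp_all add: endo_tensor_not_dual endo_tensor_form B_bilin)

lemma endo_tensor_diff: "endo_tensor S - endo_tensor T = endo_tensor (\<lambda>u. S u - T u)"
  by (rule eq_endo_tensorI) (simp_all add: endo_tensor_not_dual endo_tensor_form B_bilin)

lemma endo_tensor_scale: "tensor2_scale c (endo_tensor T) = endo_tensor (\<lambda>u. c *s T u)"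
  by (rule eq_endo_tensorI)
    (simp_all add: endo_tensor_not_dual endo_tensor_form B_bilin tensor2_scale_def)

lemma endo_tensor_flip:
  assumes "\<And>u v. B u (T v) = B v (T' u)"
  shows "\<tau> (endo_tensor T) = endo_tensor T'"
  by (rule eq_endo_tensorI) (auto simp: flip_def endo_tensor_not_dual endo_tensor_form assms)

text \<open>The first leg is paired with \<open>B u\<close>, so \<open>S\<close> acts there by
  precomposing \<open>T\<close> with its adjoint \<open>S'\<close>.\<close>

lemma endo_tensor_tmap_left:
  assumes "\<And>u x. B u (S x) = B (S' u) x"
  shows "(S \<otimes>\<^sub>m id) (endo_tensor T) = endo_tensor (\<lambda>u. T (S' u))"
  by (rule eq_endo_tensorI) (auto simp: tmap_def form_in_dual endo_tensor_form assms)

text \<open>On the second leg \<open>S\<close> acts by postcomposition. The adjoint serves to show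
  that \<open>B v\<close> composed with \<open>S\<close> is again of the form
  \<open>B (S' v)\<close>.\<close>

lemma endo_tensor_tmap_right:
  assumes "\<And>v x. B v (S x) = B (S' v) x"
  shows "(id \<otimes>\<^sub>m S) (endo_tensor T) = endo_tensor (\<lambda>u. S (T u))"
proof (rule eq_endo_tensorI)
  fix u v
  have "(\<lambda>x. B v (S x)) = B (S' v)"
    using assms by blast
  then show "(id \<otimes>\<^sub>m S) (endo_tensor T) (B u) (B v) = B v (S (T u))"
    by (simp add: tmap_def form_in_dual endo_tensor_form assms)
qed (auto simp: tmap_def)

lemma tmap_Rmul_left:
  "(Rmul (\<rhd>) x \<otimes>\<^sub>m id) (endo_tensor T) = endo_tensor (\<lambda>u. T (x \<star> u))"
  "(Rmul (\<lhd>) x \<otimes>\<^sub>m id) (endo_tensor T) = endo_tensor (\<lambda>u. T (x \<rhd> u))"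
  "(Rmul (\<star>) x \<otimes>\<^sub>m id) (endo_tensor T) = endo_tensor (\<lambda>u. T (- (x \<lhd> u)))"
  by (rule endo_tensor_tmap_left;
      simp add: Rmul_def form_rhd_right form_lhd_right form_star_right)+

lemma tmap_Lmul_left:
  "(Lmul (\<rhd>) x \<otimes>\<^sub>m id) (endo_tensor T) = endo_tensor (\<lambda>u. T (u \<lhd> x))"
  "(Lmul (\<lhd>) x \<otimes>\<^sub>m id) (endo_tensor T) = endo_tensor (\<lambda>u. T (- (u \<star> x)))"
  "(Lmul (\<star>) x \<otimes>\<^sub>m id) (endo_tensor T) = endo_tensor (\<lambda>u. T (u \<rhd> x))"
  by (rule endo_tensor_tmap_left;
      simp add: Lmul_def form_rhd_left form_lhd_left form_star_left B_bilin)+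

lemma tmap_mult_right:
  "(id \<otimes>\<^sub>m Rmul (\<rhd>) x) (endo_tensor T) = endo_tensor (\<lambda>u. T u \<rhd> x)"
  "(id \<otimes>\<^sub>m Rmul (\<lhd>) x) (endo_tensor T) = endo_tensor (\<lambda>u. T u \<lhd> x)"
  "(id \<otimes>\<^sub>m Lmul (\<rhd>) x) (endo_tensor T) = endo_tensor (\<lambda>u. x \<rhd> T u)"
  "(id \<otimes>\<^sub>m Lmul (\<lhd>) x) (endo_tensor T) = endo_tensor (\<lambda>u. x \<lhd> T u)"
  "(id \<otimes>\<^sub>m Lmul (\<star>) x) (endo_tensor T) = endo_tensor (\<lambda>u. x \<star> T u)"
proof -
  show "(id \<otimes>\<^sub>m Rmul (\<rhd>) x) (endo_tensor T) = endo_tensor (\<lambda>u. T u \<rhd> x)"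
    by (subst endo_tensor_tmap_right[where S' = "\<lambda>v. x \<star> v"]) (simp_all add: Rmul_def form_rhd_right)
  show "(id \<otimes>\<^sub>m Rmul (\<lhd>) x) (endo_tensor T) = endo_tensor (\<lambda>u. T u \<lhd> x)"
    by (subst endo_tensor_tmap_right[where S' = "\<lambda>v. x \<rhd> v"]) (simp_all add: Rmul_def form_lhd_right)
  show "(id \<otimes>\<^sub>m Lmul (\<rhd>) x) (endo_tensor T) = endo_tensor (\<lambda>u. x \<rhd> T u)"
    by (subst endo_tensor_tmap_right[where S' = "\<lambda>v. v \<lhd> x"]) (simp_all add: Lmul_def form_lhd_left)
  show "(id \<otimes>\<^sub>m Lmul (\<lhd>) x) (endo_tensor T) = endo_tensor (\<lambda>u. x \<lhd> T u)"
    by (subst endo_tensor_tmap_right[where S' = "\<lambda>v. - (v \<star> x)"])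
      (simp_all add: Lmul_def form_star_left B_bilin)
  show "(id \<otimes>\<^sub>m Lmul (\<star>) x) (endo_tensor T) = endo_tensor (\<lambda>u. x \<star> T u)"
    by (subst endo_tensor_tmap_right[where S' = "\<lambda>v. v \<rhd> x"]) (simp_all add: Lmul_def form_rhd_left)
qed

lemma endo_tensor_in_tensor2:
  assumes "Vector_Spaces.linear scale scale T"
  shows "endo_tensor T \<in> tensor2"
proof -
  interpret T: Vector_Spaces.linear scale scale T by fact
  \<comment> \<open>The basis dual to \<open>Basis\<close> under the form: \<open>B (c e)\<close> is
    the coordinate functional of \<open>e\<close>. Expanding \<open>u\<close> in it exhibits the
    tensor as the sum of \<open>e \<otimes> T (c e)\<close>.\<close>
  define c where "c e = inv (form_map B) (\<lambda>x. representation Basis x e)" for e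
  have c: "B (c e) x = representation Basis x e" for e x
    using dualE[OF representation_dual[of e]] inv_form_map unfolding c_def by metis
  have u: "u = (\<Sum>e\<in>Basis. B u e *s c e)" for u
  proof -
    have "B (\<Sum>e\<in>Basis. B u e *s c e) v = B u v" for v
    proof -
      have "B u v = B u (\<Sum>e\<in>Basis. representation Basis v e *s e)"
        using basis_expansion[of v] by simp
      then show ?thesis by (simp add: B_bilin c mult.commute)
    qed
    then show ?thesis
      using form_nondegenerate[of "u - (\<Sum>e\<in>Basis. B u e *s c e)"] by (simp add: B_bilin(3))
  qed
  have "(\<Sum>e\<in>Basis. e \<otimes> T (c e)) = endo_tensor T"
  proof (rule eq_endo_tensorI)
    fix u v
    have "B v (T u) = B v (T (\<Sum>e\<in>Basis. B u e *s c e))"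
      using u[of u] by simp
    then show "(\<Sum>e\<in>Basis. e \<otimes> T (c e)) (B u) (B v) = B v (T u)"
      by (simp add: sum_fun_apply pure2_def form_in_dual T.sum T.scale B_bilin)
  qed (auto simp: sum_fun_apply pure2_def)
  then show ?thesis
    using sum_pure2_in_tensor2[OF finite_Basis, of "\<lambda>e. e" "\<lambda>e. T (c e)"] by simp
qed

text \<open>The premise on \<open>m\<close> says that \<delta> is the transpose of the product
  \<open>m\<close>: the functional \<open>\<lambda>y. \<delta> y f g\<close> is
  \<open>B (m u v)\<close>. Inserting it into \<open>\<delta>'\<close> nests the products, so
  coalgebra identities become identities between products.\<close>

lemma map_left_dual_product:
  assumes \<delta>: "\<And>y. \<delta> y = endo_tensor (T y)" and m: "\<And>u v y. B v (T y u) = B (m u v) y"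
    and \<delta>': "\<And>y. \<delta>' y = endo_tensor (T' y)" and m': "\<And>u v y. B v (T' y u) = B (m' u v) y"
    and "T' x 0 = 0"
  shows "map_left \<delta> (\<delta>' x) f g h =
    (if f \<in> dual \<and> g \<in> dual \<and> h \<in> dual then
       B (m' (m (inv (form_map B) f) (inv (form_map B) g)) (inv (form_map B) h)) x else 0)"
proof -
  let ?k = "\<lambda>y. \<delta> y f g"
  consider (in_dual) "f \<in> dual \<and> g \<in> dual \<and> h \<in> dual" | (h) "h \<notin> dual"
    | (fg) "\<not> (f \<in> dual \<and> g \<in> dual)" "h \<in> dual" by blast
  then show ?thesis
  proof cases
    case in_dual
    then obtain u v w where uvw: "f = B u" "g = B v" "h = B w" by (meson dualE)
    then have "?k = B (m u v)" by (auto simp: \<delta> m endo_tensor_form)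
    then show ?thesis
      using uvw by (simp add: map_left_def \<delta>' endo_tensor_form m' inv_form_map form_in_dual)
  next
    case h
    then show ?thesis by (simp add: map_left_def \<delta>' endo_tensor_not_dual)
  next
    case fg
    \<comment> \<open>Off the dual space the default value 0 yields the zero functional
      \<open>B 0\<close>, which is itself linear; \<open>T' x 0 = 0\<close> makes the outer tensor
      vanish on it.\<close>
    then have k: "?k = B 0"
      by (auto simp: \<delta> B_bilin endo_tensor_not_dual fun_eq_iff)
    obtain w where w: "h = B w" using fg(2) by (rule dualE)
    show ?thesis
      using fg by (auto simp: map_left_def \<delta>' k w endo_tensor_form \<open>T' x 0 = 0\<close> B_bilin)
  qed
qed

lemma map_right_dual_product:
  assumes \<delta>: "\<And>y. \<delta> y = endo_tensor (T y)" and m: "\<And>u v y. B v (T y u) = B (m u v) y"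
    and \<delta>': "\<And>y. \<delta>' y = endo_tensor (T' y)" and m': "\<And>u v y. B v (T' y u) = B (m' u v) y"
  shows "map_right \<delta> (\<delta>' x) f g h =
    (if f \<in> dual \<and> g \<in> dual \<and> h \<in> dual then
       B (m' (inv (form_map B) f) (m (inv (form_map B) g) (inv (form_map B) h))) x else 0)"
proof -
  let ?k = "\<lambda>y. \<delta> y g h"
  consider (in_dual) "f \<in> dual \<and> g \<in> dual \<and> h \<in> dual" | (f) "f \<notin> dual"
    | (gh) "\<not> (g \<in> dual \<and> h \<in> dual)" "f \<in> dual" by blast
  then show ?thesis
  proof cases
    case in_dual
    then obtain u v w where uvw: "f = B u" "g = B v" "h = B w" by (meson dualE)
    then have "?k = B (m v w)" by (auto simp: \<delta> m endo_tensor_form)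
    then show ?thesis
      using uvw by (simp add: map_right_def \<delta>' endo_tensor_form m' inv_form_map form_in_dual)
  next
    case f
    then show ?thesis by (simp add: map_right_def \<delta>' endo_tensor_not_dual)
  next
    case gh
    \<comment> \<open>The zero functional now sits in the second slot, where the value
      \<open>B 0 (T' x u)\<close> is 0.\<close>
    then have k: "?k = B 0"
      by (auto simp: \<delta> B_bilin endo_tensor_not_dual fun_eq_iff)
    obtain u where u: "f = B u" using gh(2) by (rule dualE)
    show ?thesis
      using gh by (auto simp: map_right_def \<delta>' k u endo_tensor_form B_bilin)
  qed
qed

end

section \<open>Weight 0: symmetry of the tensor and the Yang-Baxter equation\<close>

locale skew_rota_baxter_frobenius_dialgebra_0 =
  skew_rota_baxter_frobenius_dialgebra scale Basis rhd lhd B P 0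
  for scale :: "'f::field_char_0 \<Rightarrow> 'a::ab_group_add \<Rightarrow> 'a" (infixr \<open>*s\<close> 75)
    and Basis :: "'a set"
    and rhd :: "'a \<Rightarrow> 'a \<Rightarrow> 'a" (infixl \<open>\<rhd>\<close> 70)
    and lhd :: "'a \<Rightarrow> 'a \<Rightarrow> 'a" (infixl \<open>\<lhd>\<close> 70)
    and B :: "'a \<Rightarrow> 'a \<Rightarrow> 'f"
    and P :: "'a \<Rightarrow> 'a"
begin

sublocale P: Vector_Spaces.linear scale scale P
  using operator_rota_baxter by (simp add: rota_baxter_def)

lemmas P_lin = P.add P.diff P.neg P.scale P.zero

lemma P_rhd: "P x \<rhd> P y = P (P x \<rhd> y + x \<rhd> P y)"
  using operator_rota_baxter by (simp add: rota_baxter_def)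

lemma P_lhd: "P x \<lhd> P y = P (P x \<lhd> y + x \<lhd> P y)"
  using operator_rota_baxter by (simp add: rota_baxter_def)

lemma form_P: "B x (P y) = - B (P x) y"
  using operator_form[of x y] by (simp add: eq_neg_iff_add_eq_0 add.commute)

text \<open>Two signs cancel: \<open>P\<close> is skew-adjoint and \<open>B\<close> is
  skew-symmetric. This is the symmetry of the tensor of \<open>P\<close>.\<close>

lemma form_P_swap: "B u (P v) = B v (P u)"
  using form_P[of u v] form_skew[of "P u" v] by simp

lemma endo_tensor_P_symmetric: "\<tau> (endo_tensor P) = endo_tensor P"
  by (rule endo_tensor_flip) (rule form_P_swap)

lemma endo_tensor_P_daybe: "daybe (endo_tensor P)"
  unfolding daybe_def
proof (intro conjI allI impI)
  show "endo_tensor P \<in> tensor2"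
    by (rule endo_tensor_in_tensor2) (rule P.linear_axioms)
next
  fix n :: nat and a b
  assume r: "endo_tensor P = (\<Sum>i<n. a i \<otimes> b i)"
  have form_r: "B v (P u) = (\<Sum>i<n. B u (a i) * B v (b i))" for u v
    by (simp add: endo_tensor_form[symmetric] r sum_fun_apply pure2_def form_in_dual)
  have Pb: "P u = (\<Sum>i<n. B u (a i) *s b i)" for u
    by (rule form_eqI) (simp add: form_r B_bilin)
  \<comment> \<open>By symmetry \<open>P\<close> can also be expanded along the first legs
    \<open>a i\<close>, with coefficients read off the second.\<close>
  have Pa: "P v = (\<Sum>i<n. B v (b i) *s a i)" for v
  proof (rule form_eqI)
    fix u
    have "B u (P v) = B v (P u)" by (rule form_P_swap)
    then show "B u (P v) = B u (\<Sum>i<n. B v (b i) *s a i)"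
      unfolding form_r[of v u] by (simp add: B_bilin mult.commute)
  qed
  show "(\<Sum>i<n. \<Sum>j<n. pure3 (a i) (a j) (b i \<rhd> b j) - pure3 (a j) (a i \<lhd> b j) (b i)
      - pure3 (a i \<star> a j) (b i) (b j)) = 0" (is "?D = 0")
  proof (intro ext)
    fix f g h
    show "?D f g h = 0 f g h"
    proof (cases "f \<in> dual \<and> g \<in> dual \<and> h \<in> dual")
      case False
      then show ?thesis by (auto simp: sum_fun_apply pure3_def)
    next
      case True
      then obtain u v w where uvw: "f = B u" "g = B v" "h = B w" by (meson dualE)
      have 1: "B w (P u \<rhd> P v) = (\<Sum>i<n. \<Sum>j<n. B u (a i) * B v (a j) * B w (b i \<rhd> b j))"
        by (simp add: Pb rhd_bilin B_bilin sum_distrib_left mult_ac) (rule sum.swap)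
      \<comment> \<open>The factors use different legs, \<open>P w\<close> the first and
        \<open>P u\<close> the second, so they are rewritten one at a time.\<close>
      have 2: "B v (P w \<lhd> P u) = (\<Sum>i<n. \<Sum>j<n. B u (a j) * B v (a i \<lhd> b j) * B w (b i))"
        by (subst Pa, subst Pb) (simp add: lhd_bilin B_bilin sum_distrib_left mult_ac, rule sum.swap)
      have 3: "B u (P v \<star> P w) = (\<Sum>i<n. \<Sum>j<n. B u (a i \<star> a j) * B v (b i) * B w (b j))"
        by (simp add: Pa star_bilin B_bilin sum_distrib_left mult_ac) (rule sum.swap)
      \<comment> \<open>The Rota-Baxter identity writes the product as a value of \<open>P\<close>,
        and skew-adjointness moves that \<open>P\<close> to \<open>w\<close>. Invariance then
        identifies the two terms with the other two sums of the equation.\<close>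
      have "B w (P u \<rhd> P v) = - B (P w) (P u \<rhd> v) - B (P w) (u \<rhd> P v)"
        by (simp add: P_rhd form_P B_bilin)
      moreover have "B (P w) (u \<rhd> P v) = - B u (P v \<star> P w)"
        using form_rhd_right[of "P w" u "P v"] form_skew[of u] by simp
      moreover have "B (P w) (P u \<rhd> v) = - B v (P w \<lhd> P u)"
        using form_lhd_left[of "P w" "P u" v] form_skew[of v] by simp
      ultimately have "B w (P u \<rhd> P v) - B v (P w \<lhd> P u) - B u (P v \<star> P w) = 0"
        by simp
      then show ?thesis
        by (simp add: uvw form_in_dual sum_fun_apply pure3_def 1 2 3 sum_subtractf)
    qed
  qed
qed

section \<open>The coproducts as commutators with \<open>P\<close>, and the bi-dialgebra
  axioms\<close>

abbreviation \<delta>r :: "'a \<Rightarrow> ('a, 'f) tensor2" where "\<delta>r \<equiv> delta_rhd (endo_tensor P)"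
abbreviation \<delta>l :: "'a \<Rightarrow> ('a, 'f) tensor2" where "\<delta>l \<equiv> delta_lhd (endo_tensor P)"

lemma \<delta>r_endo: "\<delta>r x = endo_tensor (\<lambda>u. x \<lhd> P u - P (x \<lhd> u))"
  unfolding delta_rhd_def tmap_Rmul_left tmap_Lmul_left tmap_mult_right endo_tensor_add by (simp add: P_lin)

lemma \<delta>l_endo: "\<delta>l x = endo_tensor (\<lambda>u. P (x \<star> u) - x \<star> P u)"
  unfolding delta_lhd_def tmap_Rmul_left tmap_Lmul_left tmap_mult_right endo_tensor_diff ..

text \<open>This supplies the product whose transpose is \<open>\<delta>r\<close>, as
  \<open>map_left_dual_product\<close> and \<open>map_right_dual_product\<close> require.\<close>

lemma \<delta>r_dual_product: "B v (x \<lhd> P u - P (x \<lhd> u)) = B (P u \<rhd> v + u \<rhd> P v) x"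
  by (simp add: B_bilin form_P form_lhd_right)

lemma \<delta>l_dual_product: "B v (P (x \<star> u) - x \<star> P u) = B (P u \<lhd> v + u \<lhd> P v) x"
  by (simp add: B_bilin form_P form_star_right)

text \<open>Flipping exchanges the factors of the dual product, which gives a commutator of
  \<open>P\<close> with a right multiplication by \<open>x\<close>.\<close>

lemma flip_\<delta>r: "\<tau> (\<delta>r x) = endo_tensor (\<lambda>u. P u \<star> x - P (u \<star> x))"
  unfolding \<delta>r_endo
  by (rule endo_tensor_flip, unfold \<delta>r_dual_product) (simp add: B_bilin form_P form_rhd_left)

lemma flip_\<delta>l: "\<tau> (\<delta>l x) = endo_tensor (\<lambda>u. P u \<rhd> x - P (u \<rhd> x))"
  unfolding \<delta>l_endo
  by (rule endo_tensor_flip, unfold \<delta>l_dual_product) (simp add: B_bilin form_P form_lhd_left)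

lemma flip_diff: "\<tau> (s - t) = \<tau> s - \<tau> t"
  by (simp add: flip_def fun_eq_iff)

lemma linear_mult_P:
  "Vector_Spaces.linear scale scale (\<lambda>u. x \<lhd> P u - P (x \<lhd> u))"
  "Vector_Spaces.linear scale scale (\<lambda>u. P (x \<star> u) - x \<star> P u)"
  by (rule linear_scaleI; simp add: P_lin lhd_bilin star_bilin scale_right_diff_distrib)+

text \<open>\<open>P\<close> is a homomorphism from the dual products to the original ones. Both
  orders of the summands are listed because \<open>add_ac\<close> may reorder them.\<close>

lemma P_homs:
  "P (P x \<rhd> y + x \<rhd> P y) = P x \<rhd> P y" "P (x \<rhd> P y + P x \<rhd> y) = P x \<rhd> P y"
  "P (P x \<lhd> y + x \<lhd> P y) = P x \<lhd> P y" "P (x \<lhd> P y + P x \<lhd> y) = P x \<lhd> P y"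
  by (simp_all add: P_rhd P_lhd add.commute)

lemma co_dialgebra: "co_dialgebra scale Basis \<delta>r \<delta>l"
proof (intro co_dialgebra.intro co_dialgebra_axioms.intro fd_space_axioms)
  fix x
  show "\<delta>r x \<in> tensor2" "\<delta>l x \<in> tensor2"
    by (simp_all add: \<delta>r_endo \<delta>l_endo endo_tensor_in_tensor2 linear_mult_P)
  show "Vector_Spaces.linear scale tensor2_scale \<delta>r" "Vector_Spaces.linear scale tensor2_scale \<delta>l"
    by (rule linear_tensor2I; simp add: \<delta>r_endo \<delta>l_endo endo_tensor_add endo_tensor_scale
        P_lin lhd_bilin star_bilin scale_right_diff_distrib algebra_simps)+
  have zero: "x \<lhd> P 0 - P (x \<lhd> 0) = 0" "P (x \<star> 0) - x \<star> P 0 = 0"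
    by (simp_all add: P_lin star_def rhd_bilin lhd_bilin)
  note left_r = map_left_dual_product[OF \<delta>r_endo \<delta>r_dual_product]
  note left_l = map_left_dual_product[OF \<delta>l_endo \<delta>l_dual_product]
  note right_r = map_right_dual_product[OF \<delta>r_endo \<delta>r_dual_product]
  note right_l = map_right_dual_product[OF \<delta>l_endo \<delta>l_dual_product]
  \<comment> \<open>All eight composites of the coproducts, evaluated as nested dual
    products.\<close>
  note eval =
    left_r[OF \<delta>r_endo \<delta>r_dual_product zero(1)] left_r[OF \<delta>l_endo \<delta>l_dual_product zero(2)]
    left_l[OF \<delta>r_endo \<delta>r_dual_product zero(1)] left_l[OF \<delta>l_endo \<delta>l_dual_product zero(2)]
    right_r[OF \<delta>r_endo \<delta>r_dual_product] right_r[OF \<delta>l_endo \<delta>l_dual_product]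
    right_l[OF \<delta>r_endo \<delta>r_dual_product] right_l[OF \<delta>l_endo \<delta>l_dual_product]
  show "map_left \<delta>r (\<delta>r x) = map_right \<delta>r (\<delta>r x)"
    "map_left \<delta>l (\<delta>l x) = map_right \<delta>l (\<delta>l x)"
    "map_right \<delta>l (\<delta>l x) = map_right \<delta>r (\<delta>l x)"
    "map_left \<delta>r (\<delta>l x) = map_right \<delta>l (\<delta>r x)"
    "map_left \<delta>l (\<delta>r x) = map_left \<delta>r (\<delta>r x)"
    \<comment> \<open>By \<open>P_homs\<close>, a triple dual product is a sum of three terms, each
      with \<open>P\<close> on two of the three factors. The terms match by the dialgebra
      axioms.\<close>
    by (intro ext; simp add: eval P_homs rhd_bilin(1,2) lhd_bilin(1,2)
        rhd_assoc lhd_assoc lhd_rhd rhd_lhd lhd_absorb add_ac)+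
qed

lemmas tmap_simps = tmap_Rmul_left tmap_Lmul_left tmap_mult_right endo_tensor_add endo_tensor_diff
lemmas dialgebra_simps = star_def rhd_bilin lhd_bilin P_lin
  rhd_assoc lhd_assoc rhd_lhd lhd_rhd

text \<open>Each condition compares two endomorphisms at \<open>u\<close>, and follows from
  linearity of \<open>P\<close> and the dialgebra axioms. In the first one, the terms other than
  \<open>x \<lhd> P (y \<star> u)\<close> vanish by \<open>lhd_absorb\<close>.\<close>

lemma bi_dialgebra: "bi_dialgebra scale Basis rhd lhd \<delta>r \<delta>l"
proof -
  interpret co_dialgebra scale Basis \<delta>r \<delta>l by (rule co_dialgebra)
  show ?thesis
  \<comment> \<open>Flips are evaluated before \<open>\<delta>r_endo\<close> and
    \<open>\<delta>l_endo\<close> are unfolded, while the coproducts under \<open>\<tau>\<close> are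
    still in the form that the flip rules match.\<close>
  proof (unfold_locales, unfold flip_diff flip_\<delta>r flip_\<delta>l, unfold \<delta>r_endo \<delta>l_endo tmap_simps)
  qed (rule arg_cong[of _ _ endo_tensor], rule ext, simp add: dialgebra_simps lhd_absorb algebra_simps)+
qed

lemma triangular: "triangular_bi_dialgebra scale Basis rhd lhd \<delta>r \<delta>l (endo_tensor P)"
proof -
  interpret bi_dialgebra scale Basis rhd lhd \<delta>r \<delta>l by (rule bi_dialgebra)
  show ?thesis
    by unfold_locales (simp_all add: endo_tensor_P_daybe endo_tensor_P_symmetric)
qed

end

theorem proposition4p24:
  fixes scale :: "'f::field_char_0 \<Rightarrow> 'a::ab_group_add \<Rightarrow> 'a" and Basis :: "'a set"
    and rhd lhd :: "'a \<Rightarrow> 'a \<Rightarrow> 'a" and B :: "'a \<Rightarrow> 'a \<Rightarrow> 'f" and P :: "'a \<Rightarrow> 'a"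
  assumes "skew_rota_baxter_frobenius_dialgebra scale Basis rhd lhd B P 0"
  shows "let r = fd_space.tensor_form scale (P \<circ> inv (form_map B)) in
    triangular_bi_dialgebra scale Basis rhd lhd
      (dialgebra.delta_rhd scale rhd lhd r) (dialgebra.delta_lhd scale rhd lhd r) r"
proof -
  interpret skew_rota_baxter_frobenius_dialgebra_0 scale Basis rhd lhd B P
    using assms by (simp add: skew_rota_baxter_frobenius_dialgebra_0_def)
  show ?thesis
    using triangular by (simp add: endo_tensor_def)
qed

end
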